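(* Let $(K,v)$ be a valued field with valuation ring $\mathcal{O}_v$, and let $I_1,I_2$ be $\mathcal{O}_v$-ideals. i) Assume that $\mathcal{O}(I_2)\subsetneq\mathcal{O}(I_1)$. Then there exists $a\in I_2$ such that $I_2':=a\mathcal{M}(I_1)\subsetneq I_2$ is the largest $\mathcal{O}(I_1)$-ideal contained in $I_2$. ii) Assume that $\mathcal{O}(I_1)=\mathcal{O}(I_2)$ and $I_1$ is a nonprincipal $\mathcal{O}(I_1)$-ideal, but $I_2$ is a principal $\mathcal{O}(I_1)$-ideal, say $I_2=a\mathcal{O}(I_1)$ for some $a\in K$. In this case, $I_2':=a\mathcal{M}(I_1)\subsetneq I_2$ is the largest nonprincipal $\mathcal{O}(I_1)$-ideal contained in $I_2$. In both cases, $J=I_2':I_1$ is the largest $\mathcal{O}_v$-ideal $J$ with $I_1J=I_2'$, and $I_2':I_1=I_2:I_1$.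
   Context: For a valuation ring $\mathcal{O}$ of $K$, an $\mathcal{O}$-ideal means a nonzero $\mathcal{O}$-submodule $I\subsetneq K$ (so fractional ideals are included). It is principal if it is of the form $a\mathcal{O}$ with $a\in K$, and nonprincipal otherwise. "Largest" refers to inclusion. For $\mathcal{O}_v$-ideals, $I_2:I_1:=\{a\in K\mid aI_1\subseteq I_2\}$, and $I_1J$ is the usual product of ideals. For an $\mathcal{O}_v$-ideal $I$, $\mathcal{O}(I):=\{b\in K\mid bI\subseteq I\}$ and $\mathcal{M}(I):=\{b\in K\mid bI\subsetneq I\}$; $\mathcal{O}(I)$ is a valuation ring of $K$ containing $\mathcal{O}_v$, with maximal ideal $\mathcal{M}(I)$, and $I$ is an $\mathcal{O}(I)$-ideal. *)

theory Defs
  imports Complex_Main "HOL-Library.Extended"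
begin

text \<open>
  Krull valuations of arbitrary rank on a field, written additively, with value \<open>\<infinity>\<close> (here
  \<open>Pinf\<close>) exactly at \<open>0\<close>. The group type is not required to be the value group itself: the value
  group is the image of the nonzero elements. The library type also contains \<open>Minf\<close>, which is
  excluded as a value.
\<close>

locale valuation =
  fixes v :: "'a::field \<Rightarrow> 'g::linordered_ab_group_add extended"
  assumes not_Minf: "v x \<noteq> Minf"
    and Pinf_iff: "v x = Pinf \<longleftrightarrow> x = 0"
    and mult: "v (x * y) = v x + v y"
    and add: "min (v x) (v y) \<le> v (x + y)"

definition valuation_ring :: "('a::field \<Rightarrow> 'g::linordered_ab_group_add extended) \<Rightarrow> 'a set"
  where "valuation_ring v = {x. 0 \<le> v x}"

text \<open>
  Fractional ideals of a subring \<open>R\<close> of the field; \<open>R\<close> is a valuation ring wherever this is used.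
  The whole field is excluded, and ideals need not be contained in \<open>R\<close>.
\<close>

definition ideal_of :: "'a::field set \<Rightarrow> 'a set \<Rightarrow> bool"
  where "ideal_of R I \<longleftrightarrow>
    0 \<in> I \<and> (\<forall>x\<in>I. \<forall>y\<in>I. x - y \<in> I) \<and> (\<forall>r\<in>R. \<forall>x\<in>I. r * x \<in> I) \<and>
    I \<noteq> {0} \<and> I \<subset> UNIV"

definition scale :: "'a::field \<Rightarrow> 'a set \<Rightarrow> 'a set"
  where "scale a I = (\<lambda>x. a * x) ` I"

definition principal_ideal_of :: "'a::field set \<Rightarrow> 'a set \<Rightarrow> bool"
  where "principal_ideal_of R I \<longleftrightarrow> ideal_of R I \<and> (\<exists>a. I = scale a R)"

definition nonprincipal_ideal_of :: "'a::field set \<Rightarrow> 'a set \<Rightarrow> bool"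
  where "nonprincipal_ideal_of R I \<longleftrightarrow> ideal_of R I \<and> \<not> (\<exists>a. I = scale a R)"

definition ideal_times :: "'a::field set \<Rightarrow> 'a set \<Rightarrow> 'a set"
  where "ideal_times I J =
    {\<Sum>k<n. f k * g k | (n::nat) f g. \<forall>k<n. f k \<in> I \<and> g k \<in> J}"

definition ideal_colon :: "'a::field set \<Rightarrow> 'a set \<Rightarrow> 'a set"
  where "ideal_colon I2 I1 = {a. scale a I1 \<subseteq> I2}"

definition ring_O :: "'a::field set \<Rightarrow> 'a set"
  where "ring_O I = {b. scale b I \<subseteq> I}"

definition max_M :: "'a::field set \<Rightarrow> 'a set"
  where "max_M I = {b. scale b I \<subset> I}"

definition largest :: "('a set \<Rightarrow> bool) \<Rightarrow> 'a set \<Rightarrow> bool"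
  where "largest P X \<longleftrightarrow> P X \<and> (\<forall>Y. P Y \<longrightarrow> Y \<subseteq> X)"

end

theory Submission
  imports Defs
begin

text \<open>
  Write \<open>O1 = ring_O I1\<close> and \<open>M1 = max_M I1\<close>. If \<open>O1\<close> is not contained in \<open>ring_O I2\<close>, there are
  \<open>a \<in> I2\<close> and \<open>b \<in> O1\<close> with \<open>b a \<notin> I2\<close>; as ideals of a valuation ring are comparable, \<open>I2\<close> lies
  strictly between \<open>a M1\<close> and \<open>a O1\<close>, and there is no \<open>O1\<close>-ideal strictly between these two. In the
  principal case the same holds with \<open>I2 = a O1\<close>, and \<open>M1\<close> is nonprincipal because \<open>M1 = c O1\<close> and
  \<open>I1\<close> nonprincipal would give \<open>I1 = c I1\<close>.

  The product formula reduces to \<open>M1 = I1 (M1 : I1)\<close>: given \<open>m \<in> M1\<close>, choose \<open>d \<in> I1\<close> outside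
  \<open>m I1\<close>; then \<open>(m / d) I1 \<subseteq> M1\<close>, and \<open>m = d (m / d)\<close>.
\<close>

section \<open>Scaled sets, products and colons of ideals\<close>

lemma mem_scale_iff: "a \<noteq> 0 \<Longrightarrow> x \<in> scale a I \<longleftrightarrow> x / a \<in> I"
  unfolding scale_def by (auto simp: image_iff intro: bexI[of _ "x / a"])

lemma mult_mem_scale: "x \<in> I \<Longrightarrow> a * x \<in> scale a I"
  unfolding scale_def by (rule imageI)

lemma scale_scale: "scale a (scale b I) = scale (a * b) I"
  by (auto simp: scale_def image_image mult.assoc)

lemma scale_one [simp]: "scale 1 I = I"
  by (simp add: scale_def)

lemma scale_mono: "I \<subseteq> J \<Longrightarrow> scale a I \<subseteq> scale a J"
  by (auto simp: scale_def)

lemma mem_ring_O: "b \<in> ring_O I \<longleftrightarrow> (\<forall>x\<in>I. b * x \<in> I)"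
  by (auto simp: ring_O_def scale_def)

lemma mem_ideal_colon: "b \<in> ideal_colon I J \<longleftrightarrow> (\<forall>x\<in>J. b * x \<in> I)"
  by (auto simp: ideal_colon_def scale_def)

lemma mult_mem_ideal_times:
  assumes "x \<in> I" "y \<in> J"
  shows "x * y \<in> ideal_times I J"
proof -
  have "x * y = (\<Sum>k<1::nat. (\<lambda>_. x) k * (\<lambda>_. y) k) \<and> (\<forall>k<1::nat. (\<lambda>_. x) k \<in> I \<and> (\<lambda>_. y) k \<in> J)"
    using assms by simp
  then show ?thesis unfolding ideal_times_def mem_Collect_eq by (intro exI)
qed

lemma ideal_of_zero: "ideal_of R I \<Longrightarrow> 0 \<in> I"
  and ideal_of_diff: "ideal_of R I \<Longrightarrow> x \<in> I \<Longrightarrow> y \<in> I \<Longrightarrow> x - y \<in> I"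
  and ideal_of_mult: "ideal_of R I \<Longrightarrow> r \<in> R \<Longrightarrow> x \<in> I \<Longrightarrow> r * x \<in> I"
  by (auto simp: ideal_of_def)

lemma ideal_of_add:
  assumes "ideal_of R I" "x \<in> I" "y \<in> I"
  shows "x + y \<in> I"
  using ideal_of_diff[OF assms(1) assms(2) ideal_of_diff[OF assms(1) ideal_of_zero[OF assms(1)] assms(3)]]
  by simp

lemma ideal_of_sum:
  assumes "ideal_of R I" "\<And>k. k \<in> A \<Longrightarrow> f k \<in> I"
  shows "sum f A \<in> I"
  using assms(2) by (induction A rule: infinite_finite_induct)
    (auto intro: ideal_of_add[OF assms(1)] ideal_of_zero[OF assms(1)])

lemma ideal_of_nonzeroE:
  assumes "ideal_of R I"
  obtains x where "x \<in> I" "x \<noteq> 0"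
  using assms by (auto simp: ideal_of_def)

lemma ideal_of_scale:
  assumes "a \<noteq> 0" "ideal_of R I"
  shows "ideal_of R (scale a I)"
proof -
  obtain x where x: "x \<in> I" "x \<noteq> 0" using assms(2) by (rule ideal_of_nonzeroE)
  obtain y where y: "y \<notin> I" using assms(2) by (auto simp: ideal_of_def)
  have "a * x \<in> scale a I" using x by (simp add: mult_mem_scale)
  moreover have "a * x \<noteq> 0" using x assms(1) by simp
  moreover have "a * y \<notin> scale a I" using y assms(1) by (simp add: mem_scale_iff)
  ultimately have "scale a I \<noteq> {0}" "scale a I \<subset> UNIV" by blast+
  moreover have "u - w \<in> scale a I" if "u \<in> scale a I" "w \<in> scale a I" for u w
    using that assms by (simp add: mem_scale_iff diff_divide_distrib ideal_of_diff)
  moreover have "r * u \<in> scale a I" if "r \<in> R" "u \<in> scale a I" for r u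
    using that assms ideal_of_mult[of R I r "u / a"] by (simp add: mem_scale_iff)
  moreover have "0 \<in> scale a I" using assms by (simp add: mem_scale_iff ideal_of_zero)
  ultimately show ?thesis by (simp add: ideal_of_def)
qed

lemma ideal_of_ring_O:
  assumes "ideal_of R I"
  shows "ideal_of (ring_O I) I"
  using assms by (auto simp: ideal_of_def mem_ring_O)

text \<open>The maximality half of the claim on the colon: a single product \<open>x * y\<close> is
  already an element of the product ideal, so each \<open>y \<in> J\<close> sends \<open>I\<close>
  into \<open>L\<close>.\<close>

lemma ideal_times_eq_imp_subset_colon:
  assumes "ideal_times I J = L"
  shows "J \<subseteq> ideal_colon L I"
  unfolding subset_iff mem_ideal_colon assms[symmetric]
  by (metis mult.commute mult_mem_ideal_times)

section \<open>The ring \<open>ring_O I\<close> and its non-units\<close>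

lemma max_M_subset_ring_O: "max_M I \<subseteq> ring_O I"
  by (auto simp: max_M_def ring_O_def)

lemma one_notin_max_M: "1 \<notin> max_M I"
  by (simp add: max_M_def)

lemma one_mem_ring_O: "1 \<in> ring_O I"
  by (simp add: mem_ring_O)

lemma ring_O_mult: "x \<in> ring_O I \<Longrightarrow> y \<in> ring_O I \<Longrightarrow> x * y \<in> ring_O I"
  by (simp add: mem_ring_O mult.assoc)

lemma ring_O_mult_max_M:
  assumes "r \<in> ring_O I" "m \<in> max_M I"
  shows "r * m \<in> max_M I"
proof -
  have "scale (r * m) I = scale m (scale r I)" by (simp add: scale_scale mult.commute)
  also have "\<dots> \<subseteq> scale m I" using assms(1) by (intro scale_mono) (simp add: ring_O_def)
  finally show ?thesis using assms(2) by (auto simp: max_M_def)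
qed

text \<open>Multiplication by a nonzero \<open>r\<close> is invertible on the field, so
  \<open>scale r I = I\<close> says that \<open>r\<close> and its inverse both preserve
  \<open>I\<close>. Thus \<open>max_M I\<close> consists of the non-units of
  \<open>ring_O I\<close>.\<close>

lemma max_M_iff_inverse:
  assumes "r \<in> ring_O I" "r \<noteq> 0"
  shows "r \<in> max_M I \<longleftrightarrow> inverse r \<notin> ring_O I"
proof
  assume "r \<in> max_M I"
  then show "inverse r \<notin> ring_O I"
    using ring_O_mult_max_M[of "inverse r" I r] one_notin_max_M[of I] assms(2) by auto
next
  assume "inverse r \<notin> ring_O I"
  then have "\<not> I \<subseteq> scale r I"
    using assms(2) by (auto simp: mem_ring_O mem_scale_iff divide_inverse mult.commute)
  then show "r \<in> max_M I" using assms(1) by (auto simp: max_M_def ring_O_def)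
qed

lemma zero_mem_max_M:
  assumes "ideal_of R I"
  shows "0 \<in> max_M I"
proof -
  have "scale 0 I = {0}" using ideal_of_zero[OF assms] by (auto simp: scale_def)
  then show ?thesis using assms by (auto simp: max_M_def ideal_of_def)
qed

text \<open>This is where \<open>I \<noteq> UNIV\<close> matters: if every scalar preserved
  \<open>I\<close>, one nonzero element would generate the whole field. It later supplies a nonzero
  element of \<open>max_M I\<close>.\<close>

lemma ring_O_neq_UNIV:
  assumes "ideal_of R I"
  shows "ring_O I \<noteq> UNIV"
proof
  assume U: "ring_O I = UNIV"
  obtain x where x: "x \<in> I" "x \<noteq> 0" using assms by (rule ideal_of_nonzeroE)
  have "y \<in> I" for y
  proof -
    have "y / x \<in> ring_O I" using U by simp
    then have "y / x * x \<in> I" using x(1) by (simp only: mem_ring_O)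
    then show ?thesis using x(2) by simp
  qed
  then show False using assms by (auto simp: ideal_of_def)
qed

text \<open>The gap argument: if some \<open>x \<in> J\<close> had \<open>x / a\<close> outside
  \<open>max_M I\<close>, then \<open>x / a\<close> would be a unit of \<open>ring_O I\<close>.
  Hence \<open>a\<close>, and with it all of \<open>scale a (ring_O I)\<close>, would lie in
  \<open>J\<close>.\<close>

lemma ideal_of_subset_scale_max_M:
  assumes "a \<noteq> 0" "ideal_of (ring_O I) J" "J \<subseteq> scale a (ring_O I)"
    and "\<not> scale a (ring_O I) \<subseteq> J" "ideal_of R I"
  shows "J \<subseteq> scale a (max_M I)"
proof
  fix x assume x: "x \<in> J"
  have r: "x / a \<in> ring_O I" using assms(1,3) x by (auto simp: mem_scale_iff)
  have "x / a \<in> max_M I"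
  proof (rule ccontr)
    assume n: "x / a \<notin> max_M I"
    have "x \<noteq> 0" using n zero_mem_max_M[OF assms(5)] by auto
    then have "inverse (x / a) \<in> ring_O I" using n r assms(1) max_M_iff_inverse[OF r] by simp
    then have "inverse (x / a) * x \<in> J" using assms(2) x ideal_of_mult by blast
    then have "a \<in> J" using \<open>x \<noteq> 0\<close> assms(1) by simp
    then have "scale a (ring_O I) \<subseteq> J"
      using ideal_of_mult[OF assms(2)] by (auto simp: scale_def mult.commute)
    then show False using assms(4) by simp
  qed
  then show "x \<in> scale a (max_M I)" using assms(1) by (simp add: mem_scale_iff)
qed

lemma scale_principal:
  assumes "b \<noteq> 0" "scale b I = scale c R"
  shows "I = scale (c / b) R"
proof -
  have "I = scale (inverse b) (scale b I)" using assms(1) by (simp add: scale_scale)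
  then show ?thesis by (simp add: assms(2) scale_scale divide_inverse mult.commute)
qed

lemma nonprincipal_scale:
  assumes "a \<noteq> 0" "nonprincipal_ideal_of R I"
  shows "nonprincipal_ideal_of R (scale a I)"
  using assms ideal_of_scale scale_principal unfolding nonprincipal_ideal_of_def by metis

section \<open>Valuation subrings of a field\<close>

locale valuation_subring =
  fixes R :: "'a::field set"
  assumes one_mem: "1 \<in> R"
    and diff_mem: "x \<in> R \<Longrightarrow> y \<in> R \<Longrightarrow> x - y \<in> R"
    and mult_mem: "x \<in> R \<Longrightarrow> y \<in> R \<Longrightarrow> x * y \<in> R"
    and mem_or_inverse_mem: "x \<in> R \<or> inverse x \<in> R"

text \<open>The value group is left behind here: all later arguments use only the four properties of
  \<open>valuation_subring\<close>.\<close>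

lemma (in valuation) valuation_subring: "valuation_subring (valuation_ring v)"
proof
  have fin: "\<exists>g. v x = Fin g" if "x \<noteq> 0" for x
    using that not_Minf[of x] Pinf_iff[of x] by (cases "v x") auto
  obtain e where e: "v 1 = Fin e" using fin[of 1] by auto
  have "Fin e = Fin e + Fin e" using mult[of 1 1] e by simp
  then have v1: "v 1 = 0" using e by (simp add: zero_extended_def)
  obtain f where f: "v (- 1) = Fin f" using fin[of "- 1"] by auto
  \<comment> \<open>An ordered group has no element of order two, so \<open>- 1\<close> has value
    zero and closure under differences follows from the axiom for sums.\<close>
  have "Fin f + Fin f = 0" using mult[of "- 1" "- 1"] f v1 by simp
  then have vm1: "v (- 1) = 0" using f by (simp add: zero_extended_def)
  show "1 \<in> valuation_ring v" by (simp add: valuation_ring_def v1)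
  show m: "x * y \<in> valuation_ring v" if "x \<in> valuation_ring v" "y \<in> valuation_ring v" for x y
    using that by (cases "v x"; cases "v y") (auto simp: valuation_ring_def mult zero_extended_def)
  show "x - y \<in> valuation_ring v" if "x \<in> valuation_ring v" "y \<in> valuation_ring v" for x y
  proof -
    have "0 \<le> v (- 1 * y)" using m[of "- 1" y] that(2) vm1 by (simp add: valuation_ring_def)
    then have "0 \<le> min (v x) (v (- y))" using that by (simp add: valuation_ring_def)
    also have "\<dots> \<le> v (x - y)" using add[of x "- y"] by simp
    finally show ?thesis by (simp add: valuation_ring_def)
  qed
  show "x \<in> valuation_ring v \<or> inverse x \<in> valuation_ring v" for x
  proof (cases "x = 0")
    case True
    then have "v x = Pinf" using Pinf_iff by blast
    then show ?thesis by (simp add: valuation_ring_def zero_extended_def)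
  next
    case False
    then obtain g h where gh: "v x = Fin g" "v (inverse x) = Fin h" using fin[of x] fin[of "inverse x"] by auto
    have "v x + v (inverse x) = 0" using False v1 by (simp flip: mult)
    then have "g + h = 0" using gh by (simp add: zero_extended_def)
    then show ?thesis using gh add_neg_neg[of g h]
      by (cases "g < 0"; cases "h < 0") (auto simp: valuation_ring_def zero_extended_def not_less)
  qed
qed

section \<open>Ideals of a valuation subring and the ideal \<open>max_M I\<close>\<close>

locale valuation_subring_ideal = valuation_subring +
  fixes I :: "'a::field set"
  assumes ideal: "ideal_of R I"
begin

lemma subset_ring_O: "R \<subseteq> ring_O I"
  using ideal by (auto simp: mem_ring_O ideal_of_def)

text \<open>Comparability of ideals in element form: otherwise \<open>x / y\<close> lies in
  \<open>R\<close> and carries \<open>y \<in> I\<close> to \<open>x\<close>.\<close>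

lemma divide_mem:
  assumes "x \<notin> I" "y \<in> I"
  shows "y / x \<in> R"
proof (rule ccontr)
  assume n: "y / x \<notin> R"
  then have "x / y \<in> R" using mem_or_inverse_mem[of "y / x"] by simp
  then have "x / y * y \<in> I" using assms(2) ideal_of_mult[OF ideal] by blast
  moreover have "y \<noteq> 0" using n diff_mem[OF one_mem one_mem] by auto
  ultimately show False using assms(1) by simp
qed

text \<open>Since \<open>ring_O I\<close> contains \<open>R\<close>, it is again a valuation ring,
  and an element whose inverse lies outside it is a non-unit. This dichotomy replaces every later
  case distinction by value.\<close>

lemma max_M_or_inverse: "x \<in> max_M I \<or> inverse x \<in> ring_O I"
  using mem_or_inverse_mem[of x] subset_ring_O max_M_iff_inverse[of x I] zero_mem_max_M[OF ideal]
  by (cases "x = 0") auto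

lemma ideal_max_M: "ideal_of (ring_O I) (max_M I)"
proof -
  have diff: "x - y \<in> max_M I" if xy: "x \<in> max_M I" "y \<in> max_M I" for x y
  proof -
    \<comment> \<open>The divisor \<open>u\<close> is factored out of the difference, leaving a
      cofactor in \<open>ring_O I\<close>. Both signs are recorded because \<open>u\<close> may turn
      out to be either \<open>x\<close> or \<open>y\<close>.\<close>
    have *: "u - w \<in> max_M I \<and> w - u \<in> max_M I"
      if u: "u \<in> max_M I" "u \<noteq> 0" and q: "w / u \<in> R" for u w
    proof -
      have "1 - w / u \<in> ring_O I" "w / u - 1 \<in> ring_O I"
        using q one_mem diff_mem subset_ring_O by auto
      then have "(1 - w / u) * u \<in> max_M I" "(w / u - 1) * u \<in> max_M I"
        using ring_O_mult_max_M u(1) by auto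
      then show ?thesis using u(2) by (simp add: algebra_simps)
    qed
    have R0: "0 \<in> R" using diff_mem[OF one_mem one_mem] by simp
    consider "x = 0" "y = 0" | "x \<noteq> 0" "y / x \<in> R" | "y \<noteq> 0" "x / y \<in> R"
      using mem_or_inverse_mem[of "x / y"] R0 by (cases "x = 0"; cases "y = 0") auto
    then show ?thesis using * xy zero_mem_max_M[OF ideal] by cases auto
  qed
  \<comment> \<open>One element outside \<open>ring_O I\<close> settles both properness conditions:
    its inverse is a nonzero member of \<open>max_M I\<close>, and \<open>z\<close> itself is not a
    member.\<close>
  obtain z where "z \<notin> ring_O I" using ring_O_neq_UNIV[OF ideal] by auto
  then have "inverse z \<noteq> 0" "inverse z \<in> max_M I" "z \<notin> max_M I"
    using max_M_or_inverse[of "inverse z"] max_M_subset_ring_O[of I] zero_mem_max_M[OF ideal] by auto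
  then have "max_M I \<noteq> {0}" "max_M I \<subset> UNIV" by blast+
  then show ?thesis
    using diff zero_mem_max_M[OF ideal] ring_O_mult_max_M unfolding ideal_of_def by blast
qed

lemma ideal_restrict: "ideal_of (ring_O I) J \<Longrightarrow> ideal_of R J"
  using subset_ring_O by (auto simp: ideal_of_def)

lemma scale_max_M_psubset: "a \<noteq> 0 \<Longrightarrow> scale a (max_M I) \<subset> scale a (ring_O I)"
  using scale_mono[OF max_M_subset_ring_O[of I], of a] one_notin_max_M[of I] one_mem_ring_O[of I]
    mem_scale_iff[of a a "max_M I"] mem_scale_iff[of a a "ring_O I"] by auto

section \<open>The product formula and the colon ideal\<close>

lemma max_M_divisor:
  assumes "m \<in> max_M I"
  obtains d where "d \<in> I" "d \<noteq> 0" "\<And>x. x \<in> I \<Longrightarrow> m / d * x \<in> max_M I"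
proof (cases "m = 0")
  case True
  then show ?thesis using that ideal_of_nonzeroE[OF ideal] zero_mem_max_M[OF ideal] by auto
next
  case False
  obtain d where d: "d \<in> I" "d \<notin> scale m I" using assms by (auto simp: max_M_def)
  have d0: "d \<noteq> 0" using d(2) ideal_of_zero[OF ideal] mult_mem_scale[of 0 I m] by auto
  \<comment> \<open>If this failed, \<open>d / (m * x)\<close> would preserve \<open>I\<close>;
    applied to \<open>x\<close> it would give \<open>d / m \<in> I\<close>, against the choice of
    \<open>d\<close>.\<close>
  have "m / d * x \<in> max_M I" if x: "x \<in> I" for x
  proof (rule ccontr)
    assume "\<not> ?thesis"
    then have "inverse (m / d * x) \<in> ring_O I" and x0: "x \<noteq> 0"
      using max_M_or_inverse[of "m / d * x"] zero_mem_max_M[OF ideal] by auto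
    then have "inverse (m / d * x) * x \<in> I" using x by (simp only: mem_ring_O)
    then have "d / m \<in> I" using x0 by (simp add: field_simps)
    then show False using d(2) False by (simp add: mem_scale_iff)
  qed
  then show ?thesis using that d(1) d0 by blast
qed

lemma largest_colon_scale_max_M:
  assumes a: "a \<noteq> 0"
  defines "L \<equiv> scale a (max_M I)"
  shows "largest (\<lambda>J. ideal_of R J \<and> ideal_times I J = L) (ideal_colon L I)"
proof -
  let ?C = "ideal_colon L I"
  have L: "ideal_of R L" unfolding L_def by (intro ideal_of_scale a ideal_restrict ideal_max_M)
  \<comment> \<open>Each \<open>y \<in> L\<close> is the single product \<open>d * (y / d)\<close>,
    so no longer sums are needed. For nonzero \<open>y\<close> the same quotient shows that the
    colon is not \<open>{0}\<close>.\<close>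
  have split: "\<exists>d\<in>I. d \<noteq> 0 \<and> y / d \<in> ?C" if y: "y \<in> L" for y
  proof -
    have "y / a \<in> max_M I" using y a by (simp add: L_def mem_scale_iff)
    then obtain d where d: "d \<in> I" "d \<noteq> 0" "\<And>x. x \<in> I \<Longrightarrow> y / a / d * x \<in> max_M I"
      using max_M_divisor by metis
    have "y / d * x \<in> L" if "x \<in> I" for x
      using d(3)[OF that] a by (simp add: L_def mem_scale_iff field_simps)
    then show ?thesis using d by (auto simp: mem_ideal_colon)
  qed
  have "ideal_times I ?C = L"
  proof
    show "ideal_times I ?C \<subseteq> L"
      unfolding ideal_times_def
      by (auto intro!: ideal_of_sum[OF L] simp: mem_ideal_colon mult.commute)
    show "L \<subseteq> ideal_times I ?C"
    proof
      fix y assume "y \<in> L"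
      then obtain d where d: "d \<in> I" "d \<noteq> 0" "y / d \<in> ?C" using split by blast
      then show "y \<in> ideal_times I ?C" using mult_mem_ideal_times[of d I "y / d" ?C] by simp
    qed
  qed
  moreover have "ideal_of R ?C"
  proof -
    obtain y where y: "y \<in> L" "y \<noteq> 0" using L by (rule ideal_of_nonzeroE)
    then obtain d where d: "d \<noteq> 0" "y / d \<in> ?C" using split by blast
    then have "y / d \<noteq> 0" using y(2) by simp
    then have "?C \<noteq> {0}" using d(2) by blast
    moreover have "?C \<subset> UNIV"
    proof -
      obtain x where x: "x \<in> I" "x \<noteq> 0" using ideal by (rule ideal_of_nonzeroE)
      obtain z where "z \<notin> L" using L by (auto simp: ideal_of_def)
      then have "z / x \<notin> ?C" using x by (auto simp: mem_ideal_colon intro!: bexI[of _ x])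
      then show ?thesis by auto
    qed
    moreover have "0 \<in> ?C" using ideal_of_zero[OF L] by (simp add: mem_ideal_colon)
    moreover have "u - w \<in> ?C" if "u \<in> ?C" "w \<in> ?C" for u w
      using that ideal_of_diff[OF L] by (simp add: mem_ideal_colon left_diff_distrib)
    moreover have "r * u \<in> ?C" if "r \<in> R" "u \<in> ?C" for r u
      using that ideal_of_mult[OF L] by (simp add: mem_ideal_colon mult.assoc)
    ultimately show ?thesis unfolding ideal_of_def by blast
  qed
  ultimately show ?thesis
    unfolding largest_def using ideal_times_eq_imp_subset_colon by blast
qed

text \<open>Restricting to nonzero \<open>b\<close> is what makes the last hypothesis usable: then
  \<open>scale b I\<close> is itself an ideal of the kind among which \<open>L\<close> is
  largest.\<close>

lemma colon_eq:
  assumes "L \<subseteq> I2" "0 \<in> L" "\<And>b. b \<noteq> 0 \<Longrightarrow> scale b I \<subseteq> I2 \<Longrightarrow> scale b I \<subseteq> L"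
  shows "ideal_colon L I = ideal_colon I2 I"
proof -
  have "scale b I \<subseteq> L" if "scale b I \<subseteq> I2" for b
  proof (cases "b = 0")
    case True
    then show ?thesis using assms(2) by (auto simp: scale_def)
  qed (use that assms(3) in blast)
  then show ?thesis using assms(1) by (auto simp: ideal_colon_def)
qed

section \<open>The largest ideals in the two cases\<close>

lemma largest_ideal_in_smaller:
  assumes I2: "ideal_of R I2" and less: "ring_O I2 \<subset> ring_O I"
  obtains a where "a \<in> I2" "a \<noteq> 0" "scale a (max_M I) \<subset> I2"
    "largest (\<lambda>J. ideal_of (ring_O I) J \<and> J \<subseteq> I2) (scale a (max_M I))"
proof -
  interpret I2: valuation_subring_ideal R I2 using I2 by unfold_locales
  obtain b a where b: "b \<in> ring_O I" and a: "a \<in> I2" and ba: "b * a \<notin> I2"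
    using less unfolding mem_ring_O[of _ I2] psubset_eq subset_iff set_eq_iff by blast
  have a0: "a \<noteq> 0" using ba ideal_of_zero[OF I2] by auto
  \<comment> \<open>Since \<open>b * a\<close> is not in \<open>I2\<close>, it divides
    \<open>x\<close> over \<open>R\<close>; multiplying the quotient by \<open>b\<close> recovers
    \<open>x / a\<close>.\<close>
  have "x / a \<in> ring_O I" if "x \<in> I2" for x
  proof -
    have "x / (b * a) \<in> ring_O I" using I2.divide_mem[OF ba that] subset_ring_O by blast
    then have "b * (x / (b * a)) \<in> ring_O I" using b ring_O_mult by blast
    moreover have "b \<noteq> 0" using ba ideal_of_zero[OF I2] by auto
    ultimately show ?thesis by simp
  qed
  then have upper: "I2 \<subseteq> scale a (ring_O I)" using a0 by (auto simp: mem_scale_iff)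
  \<comment> \<open>If \<open>a * m\<close> were outside \<open>I2\<close>, it would divide
    \<open>a \<in> I2\<close> over \<open>R\<close>, which makes \<open>m\<close> a unit of
    \<open>ring_O I\<close>.\<close>
  have "a * m \<in> I2" if m: "m \<in> max_M I" for m
  proof (rule ccontr)
    assume n: "a * m \<notin> I2"
    then have "m \<noteq> 0" using ideal_of_zero[OF I2] by auto
    moreover have "inverse m \<in> ring_O I"
      using I2.divide_mem[OF n a] subset_ring_O a0 by (auto simp: field_simps)
    ultimately show False using m max_M_iff_inverse max_M_subset_ring_O by blast
  qed
  then have "scale a (max_M I) \<subseteq> I2" by (auto simp: scale_def)
  moreover have "a \<notin> scale a (max_M I)" using a0 one_notin_max_M by (simp add: mem_scale_iff)
  ultimately have lower: "scale a (max_M I) \<subset> I2" using a by auto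
  \<comment> \<open>The element \<open>b * a\<close> witnesses that no
    \<open>J \<subseteq> I2\<close> contains \<open>scale a (ring_O I)\<close>, so the gap argument
    applies.\<close>
  have "b * a \<in> scale a (ring_O I)" using b a0 by (simp add: mem_scale_iff)
  then have "J \<subseteq> scale a (max_M I)" if "ideal_of (ring_O I) J" "J \<subseteq> I2" for J
    using that upper ba by (intro ideal_of_subset_scale_max_M[OF a0 _ _ _ ideal]) auto
  then have "largest (\<lambda>J. ideal_of (ring_O I) J \<and> J \<subseteq> I2) (scale a (max_M I))"
    using lower ideal_of_scale[OF a0 ideal_max_M] by (auto simp: largest_def)
  then show ?thesis using that a a0 lower by blast
qed

lemma nonprincipal_max_M:
  assumes "nonprincipal_ideal_of (ring_O I) I"
  shows "nonprincipal_ideal_of (ring_O I) (max_M I)"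
proof -
  have False if c: "max_M I = scale c (ring_O I)" for c
  proof -
    have "c \<in> max_M I" using c mult_mem_scale[OF one_mem_ring_O[of I], of c] by simp
    \<comment> \<open>As \<open>c \<in> max_M I\<close> means that \<open>scale c I\<close> is
      strictly smaller than \<open>I\<close>, this inclusion is the contradiction.\<close>
    moreover have "I \<subseteq> scale c I"
    proof
      fix x assume x: "x \<in> I"
      show "x \<in> scale c I"
      proof (cases "x = 0")
        case True
        then show ?thesis using mult_mem_scale[OF x, of c] by simp
      next
        case False
        have "scale x (ring_O I) \<subseteq> I" using x by (auto simp: scale_def mem_ring_O mult.commute)
        moreover have "I \<noteq> scale x (ring_O I)" using assms by (auto simp: nonprincipal_ideal_of_def)
        \<comment> \<open>Because \<open>x\<close> does not generate \<open>I\<close>, some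
          \<open>y \<in> I\<close> is not an \<open>ring_O I\<close>-multiple of \<open>x\<close>.
          Then \<open>x / y\<close> is a non-unit, hence a multiple of \<open>c\<close>.\<close>
        ultimately obtain y where y: "y \<in> I" "y / x \<notin> ring_O I" using False mem_scale_iff by blast
        then have "y \<noteq> 0" "x / y \<in> max_M I"
          using max_M_or_inverse[of "x / y"] max_M_subset_ring_O[of I] zero_mem_max_M[OF ideal] by auto
        then obtain r where r: "r \<in> ring_O I" "x / y = c * r" using c by (auto simp: scale_def)
        then have "x = c * (r * y)" using \<open>y \<noteq> 0\<close> by (simp add: field_simps)
        moreover have "r * y \<in> I" using r y by (simp add: mem_ring_O)
        ultimately show ?thesis by (simp add: mult_mem_scale)
      qed
    qed
    ultimately show False by (auto simp: max_M_def)
  qed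
  then show ?thesis using ideal_max_M by (auto simp: nonprincipal_ideal_of_def)
qed

text \<open>A nonprincipal \<open>J\<close> inside \<open>scale a (ring_O I)\<close> cannot contain
  that ideal, since it would equal it; the gap argument then pushes \<open>J\<close> into
  \<open>scale a (max_M I)\<close>.\<close>

lemma largest_nonprincipal_in_principal:
  assumes "a \<noteq> 0" "nonprincipal_ideal_of (ring_O I) I"
  shows "largest (\<lambda>J. nonprincipal_ideal_of (ring_O I) J \<and> J \<subseteq> scale a (ring_O I)) (scale a (max_M I))"
proof -
  have "J \<subseteq> scale a (max_M I)"
    if "nonprincipal_ideal_of (ring_O I) J" "J \<subseteq> scale a (ring_O I)" for J
    using that by (intro ideal_of_subset_scale_max_M[OF assms(1) _ _ _ ideal])
      (auto simp: nonprincipal_ideal_of_def)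
  then show ?thesis
    using nonprincipal_scale[OF assms(1) nonprincipal_max_M[OF assms(2)]] scale_max_M_psubset[OF assms(1)]
    by (auto simp: largest_def)
qed

end

theorem theorem3p14:
  fixes v :: "'a::field \<Rightarrow> 'g::linordered_ab_group_add extended"
    and I1 I2 :: "'a set"
  assumes "valuation v"
    and "ideal_of (valuation_ring v) I1"
    and "ideal_of (valuation_ring v) I2"
  shows
    "(ring_O I2 \<subset> ring_O I1 \<longrightarrow>
       (\<exists>a\<in>I2. \<exists>I2'. I2' = scale a (max_M I1) \<and>
          I2' \<subset> I2 \<and>
          largest (\<lambda>J. ideal_of (ring_O I1) J \<and> J \<subseteq> I2) I2' \<and>
          largest (\<lambda>J. ideal_of (valuation_ring v) J \<and> ideal_times I1 J = I2') (ideal_colon I2' I1) \<and>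
          ideal_colon I2' I1 = ideal_colon I2 I1)) \<and>
     (\<forall>a I2'. ring_O I1 = ring_O I2 \<and> nonprincipal_ideal_of (ring_O I1) I1 \<and>
          principal_ideal_of (ring_O I1) I2 \<and> I2 = scale a (ring_O I1) \<and>
          I2' = scale a (max_M I1) \<longrightarrow>
          I2' \<subset> I2 \<and>
          largest (\<lambda>J. nonprincipal_ideal_of (ring_O I1) J \<and> J \<subseteq> I2) I2' \<and>
          largest (\<lambda>J. ideal_of (valuation_ring v) J \<and> ideal_times I1 J = I2') (ideal_colon I2' I1) \<and>
          ideal_colon I2' I1 = ideal_colon I2 I1)"
proof -
  interpret valuation_subring_ideal "valuation_ring v" I1
    using valuation.valuation_subring[OF assms(1)] assms(2)
    by (simp add: valuation_subring_ideal_def valuation_subring_ideal_axioms_def)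
  have zero: "0 \<in> scale a (max_M I1)" for a
    using mult_mem_scale[OF zero_mem_max_M[OF ideal], of a] by simp
  show ?thesis
  proof (intro conjI impI allI)
    assume "ring_O I2 \<subset> ring_O I1"
    then obtain a where a: "a \<in> I2" "a \<noteq> 0" "scale a (max_M I1) \<subset> I2"
      and l: "largest (\<lambda>J. ideal_of (ring_O I1) J \<and> J \<subseteq> I2) (scale a (max_M I1))"
      by (rule largest_ideal_in_smaller[OF assms(3)])
    have "ideal_colon (scale a (max_M I1)) I1 = ideal_colon I2 I1"
    proof (rule colon_eq)
      \<comment> \<open>The scaled ideal is an \<open>ring_O I1\<close>-ideal inside
        \<open>I2\<close>, so it lies in the largest one.\<close>
      show "scale b I1 \<subseteq> scale a (max_M I1)" if "b \<noteq> 0" "scale b I1 \<subseteq> I2" for b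
        using l that ideal_of_scale[OF that(1) ideal_of_ring_O[OF ideal]] by (auto simp: largest_def)
    qed (use a zero in auto)
    then show "\<exists>a\<in>I2. \<exists>I2'. I2' = scale a (max_M I1) \<and> I2' \<subset> I2 \<and>
          largest (\<lambda>J. ideal_of (ring_O I1) J \<and> J \<subseteq> I2) I2' \<and>
          largest (\<lambda>J. ideal_of (valuation_ring v) J \<and> ideal_times I1 J = I2') (ideal_colon I2' I1) \<and>
          ideal_colon I2' I1 = ideal_colon I2 I1"
      using a l largest_colon_scale_max_M[OF a(2)] by blast
  next
    fix a I2'
    assume "ring_O I1 = ring_O I2 \<and> nonprincipal_ideal_of (ring_O I1) I1 \<and>
          principal_ideal_of (ring_O I1) I2 \<and> I2 = scale a (ring_O I1) \<and> I2' = scale a (max_M I1)"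
    then have np: "nonprincipal_ideal_of (ring_O I1) I1"
      and I2: "I2 = scale a (ring_O I1)" and I2': "I2' = scale a (max_M I1)" by blast+
    obtain x where "x \<in> I2" "x \<noteq> 0" using assms(3) by (rule ideal_of_nonzeroE)
    then have a: "a \<noteq> 0" by (auto simp: I2 scale_def)
    show less: "I2' \<subset> I2" unfolding I2 I2' by (rule scale_max_M_psubset[OF a])
    show l: "largest (\<lambda>J. nonprincipal_ideal_of (ring_O I1) J \<and> J \<subseteq> I2) I2'"
      unfolding I2 I2' by (rule largest_nonprincipal_in_principal[OF a np])
    show "largest (\<lambda>J. ideal_of (valuation_ring v) J \<and> ideal_times I1 J = I2') (ideal_colon I2' I1)"
      unfolding I2' by (rule largest_colon_scale_max_M[OF a])
    show "ideal_colon I2' I1 = ideal_colon I2 I1"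
    proof (rule colon_eq)
      \<comment> \<open>Scaling by a nonzero \<open>b\<close> keeps \<open>I1\<close> nonprincipal,
        so maximality among nonprincipal ideals suffices.\<close>
      show "scale b I1 \<subseteq> I2'" if "b \<noteq> 0" "scale b I1 \<subseteq> I2" for b
        using l that nonprincipal_scale[OF that(1) np] by (auto simp: largest_def)
    qed (use less zero I2' in auto)
  qed
qed

end
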